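(* Let $n\geq 3$. For any nonempty subset $\mathcal{I}\subseteq\{1,\dots,n-2\}$ the Hamiltonians $\mathscr{H}_{\varnothing}$ and $\mathscr{H}^Z_{\mathcal I}=\mathscr{H}_{\mathcal I}-\mathscr{H}_{\varnothing}$ Poisson-commute, that is, $$\{\mathscr{H}_{\varnothing},\mathscr{H}_{\mathcal I}^Z\}=\sum_{s,t=1}^n\left(\frac{\partial\mathscr{H}_{\varnothing}}{\partial a_{s,t}}\frac{\partial\mathscr{H}_{\mathcal I}^Z}{\partial\lambda_{s,t}}-\frac{\partial\mathscr{H}_{\varnothing}}{\partial\lambda_{s,t}}\frac{\partial\mathscr{H}_{\mathcal I}^Z}{\partial a_{s,t}}\right)=0.$$
   Context: $G=\mathrm{SL}(n,\mathbb{R})$ is regarded as a hypersurface in $\mathbb{R}^{n\times n}=\{(a_{i,j})_{1\le i,j\le n}\}$, and $\lambda_{i,j}$ denotes the cotangent coordinate dual to $\partial/\partial a_{i,j}$. In these Euclidean coordinates $(a;\lambda)$ the Hamiltonians are $$\mathscr{H}_{\varnothing}(a;\lambda)=\frac12\sum_{\substack{p,q=1\\ p\neq q}}^n\sum_{i,j=1}^na_{i,p}a_{j,q}\lambda_{j,p}\lambda_{i,q},$$ $$\mathscr{H}_{\mathcal I}(a;\lambda)=\mathscr{H}_{\varnothing}(a;\lambda)+\frac12\sum_{k,\ell\in\mathcal{I}}\sum_{i,j=1}^np^{k,\ell}(a_{i,k}\lambda_{i,k}-a_{i,n-1}\lambda_{i,n-1})(a_{j,\ell}\lambda_{j,\ell}-a_{j,n-1}\lambda_{j,n-1}),$$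 where, with $m=\#\mathcal{I}$, $p^{k,\ell}=\frac{m}{m+1}$ if $k=\ell$ and $p^{k,\ell}=-\frac{1}{m+1}$ if $k\neq\ell$ (the entries of the inverse of the $m\times m$ matrix with $2$'s on the diagonal and $1$'s off the diagonal). *)

theory Defs
  imports "HOL-Analysis.Derivative"
begin

text \<open>
  An \<open>n \<times> n\<close> real matrix is a function \<open>nat \<Rightarrow> nat \<Rightarrow> real\<close> of which only the entries with
  indices in \<open>{1..n}\<close> matter; \<open>(a, l)\<close> is a point of the cotangent bundle of the ambient
  Euclidean space of matrices, with \<open>l s t\<close> the coordinate dual to \<open>\<partial>/\<partial>a s t\<close>.
\<close>

type_synonym mat = "nat \<Rightarrow> nat \<Rightarrow> real"

definition update_entry :: "mat \<Rightarrow> nat \<Rightarrow> nat \<Rightarrow> real \<Rightarrow> mat" where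
  "update_entry a s t x = a(s := (a s)(t := x))"

definition partial_a :: "nat \<Rightarrow> nat \<Rightarrow> (mat \<Rightarrow> mat \<Rightarrow> real) \<Rightarrow> mat \<Rightarrow> mat \<Rightarrow> real" where
  "partial_a s t F a l = deriv (\<lambda>x. F (update_entry a s t x) l) (a s t)"

definition partial_l :: "nat \<Rightarrow> nat \<Rightarrow> (mat \<Rightarrow> mat \<Rightarrow> real) \<Rightarrow> mat \<Rightarrow> mat \<Rightarrow> real" where
  "partial_l s t F a l = deriv (\<lambda>x. F a (update_entry l s t x)) (l s t)"

definition poisson_bracket ::
  "nat \<Rightarrow> (mat \<Rightarrow> mat \<Rightarrow> real) \<Rightarrow> (mat \<Rightarrow> mat \<Rightarrow> real) \<Rightarrow> mat \<Rightarrow> mat \<Rightarrow> real" where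
  "poisson_bracket n F K a l =
     (\<Sum>s=1..n. \<Sum>t=1..n.
        partial_a s t F a l * partial_l s t K a l - partial_l s t F a l * partial_a s t K a l)"

definition ham_empty :: "nat \<Rightarrow> mat \<Rightarrow> mat \<Rightarrow> real" where
  "ham_empty n a l =
     1/2 * (\<Sum>p=1..n. \<Sum>q\<in>{1..n} - {p}. \<Sum>i=1..n. \<Sum>j=1..n. a i p * a j q * l j p * l i q)"

text \<open>
  The entries of the inverse of the \<open>m \<times> m\<close> matrix with 2 on and 1 off the diagonal.
\<close>

definition p_coeff :: "nat \<Rightarrow> nat \<Rightarrow> nat \<Rightarrow> real" where
  "p_coeff m k k' = (if k = k' then real m / (real m + 1) else - 1 / (real m + 1))"

definition ham :: "nat \<Rightarrow> nat set \<Rightarrow> mat \<Rightarrow> mat \<Rightarrow> real" where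
  "ham n I a l = ham_empty n a l +
     1/2 * (\<Sum>k\<in>I. \<Sum>k'\<in>I. \<Sum>i=1..n. \<Sum>j=1..n.
              p_coeff (card I) k k' * (a i k * l i k - a i (n-1) * l i (n-1))
                                    * (a j k' * l j k' - a j (n-1) * l j (n-1)))"

definition ham_Z :: "nat \<Rightarrow> nat set \<Rightarrow> mat \<Rightarrow> mat \<Rightarrow> real" where
  "ham_Z n I a l = ham n I a l - ham_empty n a l"

end

theory Submission imports Defs begin

text \<open>
  The column moments \<open>\<mu>\<^sub>k = \<Sum>\<^sub>i a\<^sub>i\<^sub>k \<lambda>\<^sub>i\<^sub>k\<close> generate the column scalings \<open>a\<^sub>\<cdot>\<^sub>k \<mapsto> c a\<^sub>\<cdot>\<^sub>k\<close>,
  \<open>\<lambda>\<^sub>\<cdot>\<^sub>k \<mapsto> c\<inverse> \<lambda>\<^sub>\<cdot>\<^sub>k\<close>.  Every monomial of the Hamiltonian \<open>ham_empty\<close> has the same degree in the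
  \<open>k\<close>-th column of \<open>a\<close> as in the \<open>k\<close>-th column of \<open>\<lambda>\<close>, so Euler's identity shows that it
  Poisson-commutes with each \<open>\<mu>\<^sub>k\<close>, and hence with \<open>ham_Z\<close>, a quadratic form in the \<open>\<mu>\<^sub>k\<close>.
\<close>

text \<open>The matrix unit: the direction in which \<open>update_entry\<close> moves.\<close>

definition unit_entry :: "nat \<Rightarrow> nat \<Rightarrow> mat" where
  "unit_entry s t i j = (if i = s \<and> j = t then 1 else 0)"

lemma update_entry_same [simp]: "update_entry a s t (a s t) = a"
  by (simp add: update_entry_def)

lemma DERIV_update_entry [derivative_intros]:
  "((\<lambda>x. update_entry a s t x i j) has_field_derivative unit_entry s t i j) (at y)"
proof -
  have "(\<lambda>x. update_entry a s t x i j) = (\<lambda>x. if i = s \<and> j = t then x else a i j)"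
    by (simp add: update_entry_def fun_eq_iff)
  then show ?thesis
    \<comment> \<open>The negated conjunction stays intact so that it decides the
      \<open>if\<close>.\<close>
    by (cases "i = s \<and> j = t") (simp_all add: unit_entry_def del: de_Morgan_conj)
qed

text \<open>Action of the Euler operator of column \<open>t\<close> on a single factor.\<close>

lemma sum_unit_entry:
  assumes "i \<in> {1..n}"
  shows "(\<Sum>s=1..n. a s t * unit_entry s t i p) = (if p = t then a i p else 0)"
proof -
  have "(\<Sum>s=1..n. a s t * unit_entry s t i p) = (\<Sum>s=1..n. if s = i then (if p = t then a i p else 0) else 0)"
    by (intro sum.cong) (auto simp: unit_entry_def)
  then show ?thesis
    using assms by simp
qed

lemma partial_a_ham_empty:
  "partial_a s t (ham_empty n) a l =
     1/2 * (\<Sum>p=1..n. \<Sum>q\<in>{1..n} - {p}. \<Sum>i=1..n. \<Sum>j=1..n.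
       (unit_entry s t i p * a j q + a i p * unit_entry s t j q) * l j p * l i q)"
  unfolding partial_a_def ham_empty_def
  by (rule DERIV_imp_deriv)
     (auto intro!: derivative_eq_intros sum.cong simp: algebra_simps)

lemma partial_l_ham_empty:
  "partial_l s t (ham_empty n) a l =
     1/2 * (\<Sum>p=1..n. \<Sum>q\<in>{1..n} - {p}. \<Sum>i=1..n. \<Sum>j=1..n.
       a i p * a j q * (unit_entry s t j p * l i q + l j p * unit_entry s t i q))"
  unfolding partial_l_def ham_empty_def
  by (rule DERIV_imp_deriv)
     (auto intro!: derivative_eq_intros sum.cong simp: algebra_simps)

lemma sum_swap4:
  fixes f :: "nat \<Rightarrow> nat \<Rightarrow> nat \<Rightarrow> nat \<Rightarrow> nat \<Rightarrow> real"
  shows "(\<Sum>s\<in>S. \<Sum>p\<in>P. \<Sum>q\<in>Q p. \<Sum>i\<in>A. \<Sum>j\<in>B. f s p q i j) =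
    (\<Sum>p\<in>P. \<Sum>q\<in>Q p. \<Sum>i\<in>A. \<Sum>j\<in>B. \<Sum>s\<in>S. f s p q i j)"
  by (simp only: sum.swap[of _ _ S])

text \<open>Each monomial is multiplied by its degree in column \<open>t\<close> of
  \<open>a\<close>; its factors \<open>a i p\<close> and \<open>a j q\<close> lie in columns
  \<open>p\<close> and \<open>q\<close>.\<close>

lemma euler_a_ham_empty:
  "(\<Sum>s=1..n. a s t * partial_a s t (ham_empty n) a l) =
     1/2 * (\<Sum>p=1..n. \<Sum>q\<in>{1..n} - {p}. \<Sum>i=1..n. \<Sum>j=1..n.
       (of_bool (p = t) + of_bool (q = t)) * (a i p * a j q * l j p * l i q))"
proof -
  have "(\<Sum>s=1..n. a s t * ((unit_entry s t i p * a j q + a i p * unit_entry s t j q) * l j p * l i q))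
      = (of_bool (p = t) + of_bool (q = t)) * (a i p * a j q * l j p * l i q)"
    if "i \<in> {1..n}" "j \<in> {1..n}" for i j p q
  proof -
    have "(\<Sum>s=1..n. a s t * ((unit_entry s t i p * a j q + a i p * unit_entry s t j q) * l j p * l i q))
      = (\<Sum>s=1..n. a s t * unit_entry s t i p) * (a j q * l j p * l i q)
      + (\<Sum>s=1..n. a s t * unit_entry s t j q) * (a i p * l j p * l i q)"
      by (simp add: sum_distrib_left sum.distrib algebra_simps)
    also have "\<dots> = (of_bool (p = t) + of_bool (q = t)) * (a i p * a j q * l j p * l i q)"
      by (simp only: sum_unit_entry that) (auto simp: algebra_simps)
    finally show ?thesis .
  qed
  then show ?thesis
    \<comment> \<open>The factor 1/2 moves out and the sum over \<open>s\<close> moves innermost;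
      there the congruence rule supplies the ranges of \<open>i\<close> and \<open>j\<close> for the
      termwise identity.\<close>
    by (simp only: partial_a_ham_empty mult.left_commute[of _ "1/2"] sum_distrib_left[of "1/2", symmetric])
       (simp only: sum_distrib_left[of "a _ t"] sum_swap4 cong: sum.cong)
qed

text \<open>The factors \<open>l j p\<close> and \<open>l i q\<close> again lie in columns
  \<open>p\<close> and \<open>q\<close>, so the weights are those of
  \<open>euler_a_ham_empty\<close>.\<close>

lemma euler_l_ham_empty:
  "(\<Sum>s=1..n. l s t * partial_l s t (ham_empty n) a l) =
     1/2 * (\<Sum>p=1..n. \<Sum>q\<in>{1..n} - {p}. \<Sum>i=1..n. \<Sum>j=1..n.
       (of_bool (p = t) + of_bool (q = t)) * (a i p * a j q * l j p * l i q))"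
proof -
  have "(\<Sum>s=1..n. l s t * (a i p * a j q * (unit_entry s t j p * l i q + l j p * unit_entry s t i q)))
      = (of_bool (p = t) + of_bool (q = t)) * (a i p * a j q * l j p * l i q)"
    if "i \<in> {1..n}" "j \<in> {1..n}" for i j p q
  proof -
    have "(\<Sum>s=1..n. l s t * (a i p * a j q * (unit_entry s t j p * l i q + l j p * unit_entry s t i q)))
      = (\<Sum>s=1..n. l s t * unit_entry s t j p) * (a i p * a j q * l i q)
      + (\<Sum>s=1..n. l s t * unit_entry s t i q) * (a i p * a j q * l j p)"
      by (simp add: sum_distrib_left sum.distrib algebra_simps)
    also have "\<dots> = (of_bool (p = t) + of_bool (q = t)) * (a i p * a j q * l j p * l i q)"
      by (simp only: sum_unit_entry that) (auto simp: algebra_simps)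
    finally show ?thesis .
  qed
  then show ?thesis
    by (simp only: partial_l_ham_empty mult.left_commute[of _ "1/2"] sum_distrib_left[of "1/2", symmetric])
       (simp only: sum_distrib_left[of "l _ t"] sum_swap4 cong: sum.cong)
qed

definition column_moment :: "nat \<Rightarrow> mat \<Rightarrow> mat \<Rightarrow> nat \<Rightarrow> real" where
  "column_moment n a l k = (\<Sum>i=1..n. a i k * l i k)"

lemma DERIV_column_moment_a [derivative_intros]:
  assumes "s \<in> {1..n}"
  shows "((\<lambda>x. column_moment n (update_entry a s t x) l k) has_field_derivative
    l s t * of_bool (k = t)) (at y)"
proof -
  have "(\<Sum>i=1..n. unit_entry s t i k * l i k) = (\<Sum>i=1..n. if i = s then l s t * of_bool (k = t) else 0)"
    by (intro sum.cong) (auto simp: unit_entry_def)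
  also have "\<dots> = l s t * of_bool (k = t)"
    using assms by simp
  finally show ?thesis
    unfolding column_moment_def by (auto intro!: derivative_eq_intros)
qed

lemma column_moment_commute: "column_moment n a l = column_moment n l a"
  by (simp add: column_moment_def mult.commute fun_eq_iff)

lemma DERIV_column_moment_l [derivative_intros]:
  assumes "s \<in> {1..n}"
  shows "((\<lambda>x. column_moment n a (update_entry l s t x) k) has_field_derivative
    a s t * of_bool (k = t)) (at y)"
  using DERIV_column_moment_a[OF assms, of l t a k y] by (simp only: column_moment_commute)

text \<open>\<open>p_coeff\<close> is independent of the rows \<open>i\<close> and \<open>j\<close>,
  so the double sum over rows factors into a product.\<close>

lemma ham_Z_column_moment:
  "ham_Z n I a l = 1/2 * (\<Sum>k\<in>I. \<Sum>k'\<in>I. p_coeff (card I) k k' *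
     ((column_moment n a l k - column_moment n a l (n-1)) *
      (column_moment n a l k' - column_moment n a l (n-1))))"
  by (simp only: ham_Z_def ham_def column_moment_def add_diff_cancel_left' mult.assoc
      sum_subtractf [symmetric] sum_product sum_distrib_left[of "p_coeff _ _ _"])

text \<open>Derivative of the quadratic form in the moments with respect to the moment of column
  \<open>t\<close>, as the product rule yields it.\<close>

definition ham_Z_gradient :: "nat \<Rightarrow> nat set \<Rightarrow> mat \<Rightarrow> mat \<Rightarrow> nat \<Rightarrow> real" where
  "ham_Z_gradient n I a l t = 1/2 * (\<Sum>k\<in>I. \<Sum>k'\<in>I. p_coeff (card I) k k' *
     ((of_bool (k = t) - of_bool (n-1 = t)) * (column_moment n a l k' - column_moment n a l (n-1)) +
      (column_moment n a l k - column_moment n a l (n-1)) * (of_bool (k' = t) - of_bool (n-1 = t))))"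

text \<open>Chain rule: only the moment of column \<open>t\<close> involves \<open>a s t\<close>,
  with derivative \<open>l s t\<close>.\<close>

lemma partial_a_ham_Z:
  assumes "s \<in> {1..n}"
  shows "partial_a s t (ham_Z n I) a l = l s t * ham_Z_gradient n I a l t"
  unfolding partial_a_def ham_Z_column_moment ham_Z_gradient_def sum_distrib_left
  using assms
  by (intro DERIV_imp_deriv)
     (rule derivative_eq_intros refl | assumption | simp add: algebra_simps)+

lemma partial_l_ham_Z:
  assumes "s \<in> {1..n}"
  shows "partial_l s t (ham_Z n I) a l = a s t * ham_Z_gradient n I a l t"
  unfolding partial_l_def ham_Z_column_moment ham_Z_gradient_def sum_distrib_left
  using assms
  by (intro DERIV_imp_deriv)
     (rule derivative_eq_intros refl | assumption | simp add: algebra_simps)+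

theorem theorem4p3:
  fixes n :: nat and I :: "nat set" and a l :: "nat \<Rightarrow> nat \<Rightarrow> real"
  assumes "n \<ge> 3" and "I \<noteq> {}" and "I \<subseteq> {1..n-2}"
  shows "poisson_bracket n (ham_empty n) (ham_Z n I) a l = 0"
proof -
  let ?H = "ham_empty n"
  let ?c = "ham_Z_gradient n I a l"
  have "poisson_bracket n ?H (ham_Z n I) a l =
    (\<Sum>s=1..n. \<Sum>t=1..n.
       ?c t * (a s t * partial_a s t ?H a l) - ?c t * (l s t * partial_l s t ?H a l))"
    unfolding poisson_bracket_def
    by (intro sum.cong refl) (simp add: partial_a_ham_Z partial_l_ham_Z)
  \<comment> \<open>\<open>?c t\<close> is independent of \<open>s\<close>, so summing over
    \<open>s\<close> first produces the two Euler sums of column \<open>t\<close>, which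
    coincide.\<close>
  also have "\<dots> = (\<Sum>t=1..n. ?c t * (\<Sum>s=1..n. a s t * partial_a s t ?H a l)
      - ?c t * (\<Sum>s=1..n. l s t * partial_l s t ?H a l))"
    by (subst sum.swap) (simp only: sum_subtractf sum_distrib_left)
  also have "\<dots> = 0"
    by (simp only: euler_a_ham_empty euler_l_ham_empty diff_self sum.neutral_const)
  finally show ?thesis .
qed

end
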